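(* For every connected graph $G$ with $n\ge2$ vertices and $m$ edges, $$0\le I_D^1(G)\le 1-\frac1n.$$
   Context: Graphs are finite and simple. The distance matrix of a connected graph $G$ with vertices $v_1,\dots,v_n$ is $D(G)=[d_{ij}]$, where $d_{ij}$ is the distance between $v_i$ and $v_j$; let $\mu_1,\dots,\mu_n$ be its eigenvalues. Put $p_i=|\mu_i|/\sum_{j=1}^n|\mu_j|$ and $I_D^1(G)=\sum_{i=1}^n p_i(1-p_i)$. *)

theory Defs
  imports
    "Graph_Theory.Shortest_Path"
    "Graph_Theory.Digraph_Component"
    "Jordan_Normal_Form.Char_Poly"
    "HOL-Computational_Algebra.Polynomial"
begin

text \<open>
  A finite simple graph is a \<^locale>\<open>graph\<close>, that is, a finite loop-free symmetric digraph
  without parallel arcs; an edge between \<open>u\<close> and \<open>v\<close> is the pair of arcs \<open>(u, v)\<close>, \<open>(v, u)\<close>.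
\<close>

definition edges :: "('a, 'b) pre_digraph \<Rightarrow> 'a set set" where
  "edges G = (\<lambda>e. {tail G e, head G e}) ` arcs G"

text \<open>
  With unit weights, the weighted distance of the library is the least length of a walk.
  It is finite in a connected graph, so \<^const>\<open>real_of_ereal\<close> loses nothing there.
\<close>

definition graph_dist :: "('a, 'b) pre_digraph \<Rightarrow> 'a \<Rightarrow> 'a \<Rightarrow> real" where
  "graph_dist G u v = real_of_ereal (wf_digraph.\<mu> G (\<lambda>_. 1) u v)"

text \<open>The list \<open>vs\<close> is the numbering of the vertices that indexes rows and columns.\<close>

definition distance_matrix :: "('a, 'b) pre_digraph \<Rightarrow> 'a list \<Rightarrow> real mat" where
  "distance_matrix G vs =
     mat (length vs) (length vs) (\<lambda>(i, j). graph_dist G (vs ! i) (vs ! j))"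

text \<open>
  All eigenvalues with algebraic multiplicity. They are taken over the complex numbers so that an
  \<open>n \<times> n\<close> matrix has exactly \<open>n\<close> of them by definition; those of a symmetric matrix are real, and
  \<^const>\<open>cmod\<close> is then their absolute value.
\<close>

definition eigenvalue_mset :: "real mat \<Rightarrow> complex multiset" where
  "eigenvalue_mset A = proots (char_poly (map_mat complex_of_real A))"

definition I_D1 :: "('a, 'b) pre_digraph \<Rightarrow> 'a list \<Rightarrow> real" where
  "I_D1 G vs =
     (let M = eigenvalue_mset (distance_matrix G vs);
          p = (\<lambda>x. cmod x / (\<Sum>y\<in>#M. cmod y))
      in \<Sum>x\<in>#M. p x * (1 - p x))"

end

theory Submission
  imports Defs
begin

text \<open>
  The quantity to be bounded is the Gini--Simpson index of the weights \<open>p\<close> that the moduli of the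
  eigenvalues define. The lower bound holds because every weight lies in the unit interval. For the
  upper bound, the concave function \<open>t (1 - t)\<close> lies below its tangent at the uniform weight
  \<open>1 / n\<close>; summing this tangent over at most \<open>n\<close> eigenvalues, whose weights sum to at most 1, gives
  the bound \<open>1 - 1 / n\<close>. There are at most \<open>n\<close> eigenvalues because the characteristic polynomial
  of an \<open>n \<times> n\<close> matrix has degree \<open>n\<close>.
\<close>

lemma sum_mset_nonneg:
  fixes f :: "'a \<Rightarrow> real"
  assumes "\<And>x. x \<in># M \<Longrightarrow> 0 \<le> f x"
  shows "0 \<le> (\<Sum>x\<in>#M. f x)"
  using assms by (induction M) auto

lemma sum_mset_divide:
  fixes f :: "'a \<Rightarrow> real"
  shows "(\<Sum>x\<in>#M. f x / c) = (\<Sum>x\<in>#M. f x) / c"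
  by (induction M) (auto simp: add_divide_distrib)

text \<open>
  Asking only for total weight at most 1, instead of exactly 1, also covers the weights that
  arise from division by a vanishing total, which are all 0. This is where \<open>n \<ge> 2\<close> matters: the
  tangent at \<open>1 / n\<close> then has slope \<open>1 - 2 / n \<ge> 0\<close>, so a smaller total weight cannot increase
  the bound.
\<close>

lemma gini_simpson_bounds:
  fixes p :: "'a \<Rightarrow> real" and M :: "'a multiset"
  assumes p_unit: "\<And>x. x \<in># M \<Longrightarrow> 0 \<le> p x \<and> p x \<le> 1"
    and total: "(\<Sum>x\<in>#M. p x) \<le> 1"
    and size: "size M \<le> n"
    and n: "n \<ge> 2"
  shows "0 \<le> (\<Sum>x\<in>#M. p x * (1 - p x))"
    and "(\<Sum>x\<in>#M. p x * (1 - p x)) \<le> 1 - 1 / real n"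
proof -
  show "0 \<le> (\<Sum>x\<in>#M. p x * (1 - p x))"
    by (rule sum_mset_nonneg) (auto dest: p_unit)
  have tangent: "t * (1 - t) \<le> (1 - 2 / real n) * t + 1 / (real n)\<^sup>2" for t :: real
    using zero_le_power2[of "t - 1 / real n"]
    by (simp add: power2_diff power_divide algebra_simps power2_eq_square)
  have "(\<Sum>x\<in>#M. p x * (1 - p x)) \<le> (\<Sum>x\<in>#M. (1 - 2 / real n) * p x + 1 / (real n)\<^sup>2)"
    by (rule sum_mset_mono) (rule tangent)
  also have "\<dots> = (1 - 2 / real n) * (\<Sum>x\<in>#M. p x) + real (size M) / (real n)\<^sup>2"
    by (simp add: sum_mset.distrib sum_mset_distrib_left image_mset.compositionality comp_def)
  also have "\<dots> \<le> (1 - 2 / real n) * 1 + real n / (real n)\<^sup>2"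
    using total size n by (intro add_mono mult_left_mono divide_right_mono) auto
  also have "\<dots> = 1 - 1 / real n"
    using n by (simp add: power2_eq_square field_simps)
  finally show "(\<Sum>x\<in>#M. p x * (1 - p x)) \<le> 1 - 1 / real n" .
qed

lemma size_eigenvalue_mset_le:
  assumes "A \<in> carrier_mat n n"
  shows "size (eigenvalue_mset A) \<le> n"
proof -
  have "degree (char_poly (map_mat complex_of_real A)) = n"
    using assms by (simp add: degree_monic_char_poly[of _ n])
  then show ?thesis
    using size_proots_le unfolding eigenvalue_mset_def by metis
qed

theorem corollary3p8:
  fixes G :: "('a, 'b) pre_digraph"
    and vs :: "'a list"
    and n m :: nat
  assumes "graph G"
    and "Digraph_Component.connected G"
    and "distinct vs" and "set vs = verts G"
    and "card (verts G) = n" and "n \<ge> 2"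
    and "card (edges G) = m"
  shows "0 \<le> I_D1 G vs \<and> I_D1 G vs \<le> 1 - 1 / real n"
proof -
  define M where "M = eigenvalue_mset (distance_matrix G vs)"
  define S where "S = (\<Sum>y\<in>#M. cmod y)"
  have "length vs = n"
    using assms(3-5) distinct_card by metis
  then have size: "size M \<le> n"
    unfolding M_def by (intro size_eigenvalue_mset_le) (simp add: distance_matrix_def)
  have S_nonneg: "0 \<le> S"
    unfolding S_def by (rule sum_mset_nonneg) auto
  have p_unit: "0 \<le> cmod x / S \<and> cmod x / S \<le> 1" if "x \<in># M" for x
  proof -
    obtain N where N: "M = add_mset x N"
      using \<open>x \<in># M\<close> by (rule mset_add)
    have "0 \<le> (\<Sum>y\<in>#N. cmod y)"
      by (rule sum_mset_nonneg) auto
    then have "cmod x \<le> S"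
      by (simp add: S_def N)
    with S_nonneg show ?thesis
      by (auto simp: divide_le_eq_1)
  qed
  have "(\<Sum>x\<in>#M. cmod x / S) = S / S"
    by (simp only: S_def sum_mset_divide)
  \<comment> \<open>An inequality, since \<open>S / S\<close> is 0 when \<open>S\<close> is 0.\<close>
  then have total: "(\<Sum>x\<in>#M. cmod x / S) \<le> 1"
    by simp
  have "I_D1 G vs = (\<Sum>x\<in>#M. cmod x / S * (1 - cmod x / S))"
    by (simp only: I_D1_def Let_def M_def S_def)
  with gini_simpson_bounds[of M "\<lambda>x. cmod x / S", OF p_unit total size \<open>n \<ge> 2\<close>]
  show ?thesis
    by simp
qed

end
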